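(* Let $x\in\mathbb{C}\setminus\delta\mathbb{Z}^{-}$, let $\delta,\rho,k,p,a,b\in\mathbb{R}^{+}\setminus\{0\}$, and let $\operatorname{Re}(x-\rho n)>0$ for $n\in\mathbb{N}$. Then the following relations hold: $$\Gamma(\delta,a;\rho,b)(x)=\frac{k}{\delta}\;\Gamma\!\left(k,a;\tfrac{k\rho}{\delta},b\right)\!\left(\tfrac{kx}{\delta}\right),$$ $$\Gamma(\delta,a;\rho,b)(x)=\frac{k}{\delta}\left(\frac{a}{p}\right)^{\frac{x}{\delta}}\;\Gamma\!\left(k,p;\tfrac{k\rho}{\delta},\,b\left(\tfrac{a}{p}\right)^{\frac{\rho}{\delta}}\right)\!\left(\tfrac{kx}{\delta}\right),$$ $$\Gamma(\delta,a;\rho,b)(x)=\left(\frac{a}{p}\right)^{\frac{x}{\delta}}\;\Gamma\!\left(\delta,p;\rho,\,b\left(\tfrac{a}{p}\right)^{\frac{\rho}{\delta}}\right)\!(x).$$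
   Context: The Four Parameter Gamma Function (ultra gamma function) is defined by $$\Gamma(\delta,a;\rho,b)(x)=\int_{0}^{\infty}t^{x-1}e^{-\frac{t^{\delta}}{a}-\frac{t^{-\rho}}{b}}\,dt,$$ where $x\in\mathbb{C}\setminus\delta\mathbb{Z}^{-}$, $\delta,\rho,a,b\in\mathbb{R}^{+}\setminus\{0\}$ and $\operatorname{Re}(x-\rho n)>0$ for $n\in\mathbb{N}$. Here $\mathbb{C}$, $\mathbb{R}^{+}$, $\mathbb{Z}^{-}$ and $\mathbb{N}$ are the sets of complex numbers, positive real numbers, negative integers and natural numbers, $\operatorname{Re}$ is the real part, and $\delta\mathbb{Z}^{-}=\{\delta m: m\in\mathbb{Z}^{-}\}$. *)

theory Defs
  imports "HOL-Analysis.Analysis"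
begin

(* For positive delta, a, rho, b the integrand is absolutely integrable on the open half-line for
   every complex x (exponential decay at both ends), so the integral below is never a default
   value. The Henstock-Kurzweil integral agrees with the improper Riemann integral. *)
definition ultra_Gamma :: "real \<Rightarrow> real \<Rightarrow> real \<Rightarrow> real \<Rightarrow> complex \<Rightarrow> complex" where
  "ultra_Gamma \<delta> a \<rho> b x =
     integral {0<..} (\<lambda>t::real.
       complex_of_real t powr (x - 1) *
       complex_of_real (exp (- (t powr \<delta>) / a - (t powr (- \<rho>)) / b)))"

definition scaled_neg_ints :: "real \<Rightarrow> complex set" where
  "scaled_neg_ints \<delta> = {complex_of_real (\<delta> * of_int m) | m :: int. m < 0}"

end

(* The substitution t = c * u powr q maps the open half-line to itself; for q = k / \<delta> or q = 1 and
   c = 1 or c = (a / p) powr (1 / \<delta>) it turns the left-hand integral into each of the right-hand ones.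
   Absolute integrability, which the change of variables formula needs, follows by the same
   substitution from that of the Gamma integral, since exp (- (t powr - \<rho>) / b) is at most 1. *)
theory Submission
  imports Defs
begin

lemma bij_betw_scaled_powr:
  fixes c q :: real
  assumes "c > 0" "q > 0"
  shows "bij_betw (\<lambda>u. c * u powr q) {0<..} {0<..}"
  by (rule bij_betw_byWitness[where f' = "\<lambda>t. (t / c) powr (1 / q)"])
     (use assms in \<open>auto simp: powr_powr\<close>)

lemma has_field_derivative_scaled_powr:
  fixes c q u :: real
  assumes "u > 0"
  shows "((\<lambda>u. c * u powr q) has_field_derivative c * q * u powr (q - 1)) (at u within S)"
  using assms by (auto intro!: derivative_eq_intros simp: divide_simps powr_diff)

text \<open>The Jacobian \<open>c * q * u powr (q - 1)\<close> is nonnegative, so the absolute value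
  in the general change of variables formula drops out, and bijectivity makes the image the whole
  open half-line again.\<close>

lemma
  fixes f :: "real \<Rightarrow> 'a :: euclidean_space"
  assumes "c > 0" "q > 0"
  shows absolutely_integrable_scaled_powr:
      "f absolutely_integrable_on {0<..} \<longleftrightarrow>
         (\<lambda>u. (c * q * u powr (q - 1)) *\<^sub>R f (c * u powr q)) absolutely_integrable_on {0<..}"
    and integral_scaled_powr:
      "f absolutely_integrable_on {0<..} \<Longrightarrow>
         integral {0<..} f = integral {0<..} (\<lambda>u. (c * q * u powr (q - 1)) *\<^sub>R f (c * u powr q))"
proof -
  let ?g = "\<lambda>u. c * u powr q" and ?g' = "\<lambda>u. c * q * u powr (q - 1)"
  have S: "{0<..} \<in> sets (lebesgue :: real measure)"
    by simp
  have der: "(?g has_field_derivative ?g' u) (at u within {0<..})" if "u \<in> {0<..}" for u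
    using that by (intro has_field_derivative_scaled_powr) simp
  have inj: "inj_on ?g {0<..}" and img: "?g ` {0<..} = {0<..}"
    using bij_betw_scaled_powr[OF assms] by (auto simp: bij_betw_def)
  have abs: "\<bar>?g' u\<bar> = ?g' u" for u
    using assms by simp
  show "f absolutely_integrable_on {0<..} \<longleftrightarrow> (\<lambda>u. ?g' u *\<^sub>R f (?g u)) absolutely_integrable_on {0<..}"
    using absolutely_integrable_change_of_variables_real[OF S der inj, of f] unfolding img abs .
  show "integral {0<..} f = integral {0<..} (\<lambda>u. ?g' u *\<^sub>R f (?g u))"
    if "f absolutely_integrable_on {0<..}"
    using has_absolute_integral_change_of_variables_real[OF S der inj, of f "integral {0<..} f"] that
    unfolding img abs by simp
qed

text \<open>No branch problem arises: for positive \<open>u\<close> the logarithm of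
  \<open>u powr r\<close> is the real number \<open>r * ln u\<close>.\<close>

lemma powr_of_real_powr:
  fixes u r :: real and z :: complex
  assumes "u > 0"
  shows "of_real (u powr r) powr z = of_real u powr (of_real r * z)"
  using assms by (simp add: powr_def Ln_of_real ac_simps flip: of_real_mult exp_of_real)

text \<open>In terms of the scale-invariant measure: dt/t = q du/u under t =
  \<open>c * u powr q\<close>, so t^x dt/t becomes q c^x u^(q x) du/u.\<close>

lemma scaled_powr_jacobian:
  fixes c q u :: real and x :: complex
  assumes "c > 0" "u > 0"
  shows "of_real (c * q * u powr (q - 1)) * of_real (c * u powr q) powr (x - 1) =
           of_real q * of_real c powr x * of_real u powr (of_real q * x - 1)"
proof -
  have scale: "of_real (c * u powr q) powr (x - 1) =
          of_real c powr (x - 1) * of_real u powr (of_real q * (x - 1))"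
    using assms by (simp add: powr_times_real powr_of_real_powr)
  have c: "of_real c * of_real c powr (x - 1) = of_real c powr x"
    using assms by (simp add: powr_diff)
  have "of_real (u powr (q - 1)) = of_real u powr (of_real q - 1 :: complex)"
    using powr_of_real[of u "q - 1"] assms by simp
  moreover have "(of_real q - 1) + of_real q * (x - 1) = of_real q * x - 1"
    by (simp add: algebra_simps)
  ultimately have u: "of_real (u powr (q - 1)) * of_real u powr (of_real q * (x - 1)) =
                   of_real u powr (of_real q * x - 1)"
    by (metis powr_add)
  have "of_real (c * q * u powr (q - 1)) * of_real (c * u powr q) powr (x - 1) =
          of_real q * (of_real c * of_real c powr (x - 1)) *
            (of_real (u powr (q - 1)) * of_real u powr (of_real q * (x - 1)))"
    unfolding scale by (simp only: of_real_mult mult_ac)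
  then show ?thesis
    by (simp only: c u)
qed

lemma ultra_Gamma_absolutely_integrable:
  assumes "\<delta> > 0" "a > 0" "b > 0" "Re x > 0"
  shows "(\<lambda>t::real. complex_of_real t powr (x - 1) *
            complex_of_real (exp (- (t powr \<delta>) / a - (t powr (- \<rho>)) / b)))
         absolutely_integrable_on {0<..}"
    (is "?F absolutely_integrable_on _")
proof -
  \<comment> \<open>Evaluating the Gamma integral at \<open>z\<close>, with rate
    \<open>1 / a\<close>, is what makes the substitution t = \<open>u powr \<delta>\<close> produce
    the power \<open>x - 1\<close>, since \<delta> z = x.\<close>
  define z where "z = x / complex_of_real \<delta>"
  have "(\<lambda>t. complex_of_real t powr (z - 1) / of_real (exp (1 / a * t))) absolutely_integrable_on {0<..}"
    using assms by (intro absolutely_integrable_Gamma_integral) (auto simp: z_def)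
  then have "(\<lambda>u. (1 * \<delta> * u powr (\<delta> - 1)) *\<^sub>R
        (complex_of_real (1 * u powr \<delta>) powr (z - 1) / of_real (exp (1 / a * (1 * u powr \<delta>)))))
      absolutely_integrable_on {0<..}"
    by (subst (asm) absolutely_integrable_scaled_powr[of 1 \<delta>]) (use assms in auto)
  then have int: "(\<lambda>u. of_real \<delta> * (complex_of_real u powr (x - 1) * of_real (exp (- (u powr \<delta>) / a))))
      absolutely_integrable_on {0<..}"
  \<comment> \<open>With an empty exceptional set this is just a pointwise rewriting of the
    integrand on the half-line.\<close>
  proof (rule absolutely_integrable_spike[OF _ negligible_empty])
    fix u :: real assume "u \<in> {0<..} - {}"
    then show "of_real \<delta> * (complex_of_real u powr (x - 1) * of_real (exp (- (u powr \<delta>) / a))) =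
      (1 * \<delta> * u powr (\<delta> - 1)) *\<^sub>R
        (complex_of_real (1 * u powr \<delta>) powr (z - 1) / of_real (exp (1 / a * (1 * u powr \<delta>))))"
      using scaled_powr_jacobian[of 1 u \<delta> z] assms
      by (simp add: z_def scaleR_conv_of_real exp_minus field_simps)
  qed
  \<comment> \<open>Positive arguments avoid the branch cut of the complex power, so the integrand
    is continuous there.\<close>
  have meas: "?F \<in> borel_measurable (lebesgue_on {0<..})"
    by (intro continuous_imp_measurable_on_sets_lebesgue continuous_intros)
       (use assms in \<open>auto simp: complex_nonpos_Reals_iff\<close>)
  \<comment> \<open>The division by \<open>\<delta>\<close> cancels the Jacobian constant kept in
    \<open>int\<close>.\<close>
  have bound: "norm (?F t) \<le> norm (of_real \<delta> * (complex_of_real t powr (x - 1) *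
                    of_real (exp (- (t powr \<delta>) / a)))) / \<delta>" for t
    using assms by (simp add: norm_mult mult_left_mono)
  show ?thesis
    by (rule measurable_bounded_by_integrable_imp_absolutely_integrable[OF meas _ _ bound])
       (use int in \<open>auto simp: absolutely_integrable_on_def intro: integrable_on_divide\<close>)
qed

text \<open>The family of integrands is closed under t = \<open>c * u powr q\<close>: the power
  \<open>q\<close> rescales the argument and both exponents, while \<open>c\<close> is absorbed into
  the two denominators and leaves the factor c^x.\<close>

lemma ultra_Gamma_scaled_powr:
  assumes "\<delta> > 0" "a > 0" "b > 0" "Re x > 0" "c > 0" "q > 0"
  shows "ultra_Gamma \<delta> a \<rho> b x =
           of_real q * of_real c powr x *
           ultra_Gamma (q * \<delta>) (a / c powr \<delta>) (q * \<rho>) (b * c powr \<rho>) (of_real q * x)"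
proof -
  define F where "F \<delta> a \<rho> b x = (\<lambda>t::real. complex_of_real t powr (x - 1) *
            complex_of_real (exp (- (t powr \<delta>) / a - (t powr (- \<rho>)) / b)))" for \<delta> a \<rho> b x
  have "ultra_Gamma \<delta> a \<rho> b x =
          integral {0<..} (\<lambda>u. (c * q * u powr (q - 1)) *\<^sub>R F \<delta> a \<rho> b x (c * u powr q))"
    unfolding ultra_Gamma_def F_def
    using assms by (intro integral_scaled_powr ultra_Gamma_absolutely_integrable)
  also have "\<dots> = integral {0<..} (\<lambda>u. of_real q * of_real c powr x *
      F (q * \<delta>) (a / c powr \<delta>) (q * \<rho>) (b * c powr \<rho>) (of_real q * x) u)"
  proof (rule integral_cong)
    fix u :: real assume "u \<in> {0<..}"
    then have u: "u > 0" by simp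
    have "- ((c * u powr q) powr \<delta>) / a - (c * u powr q) powr (- \<rho>) / b =
          - (u powr (q * \<delta>)) / (a / c powr \<delta>) - u powr (- (q * \<rho>)) / (b * c powr \<rho>)"
      using assms u by (simp add: powr_mult powr_powr powr_minus field_simps)
    then show "(c * q * u powr (q - 1)) *\<^sub>R F \<delta> a \<rho> b x (c * u powr q) =
      of_real q * of_real c powr x * F (q * \<delta>) (a / c powr \<delta>) (q * \<rho>) (b * c powr \<rho>) (of_real q * x) u"
      using scaled_powr_jacobian[OF \<open>c > 0\<close> u, of q x]
      by (simp only: F_def scaleR_conv_of_real flip: mult.assoc)
  qed
  finally show ?thesis
    by (simp add: ultra_Gamma_def F_def)
qed

theorem theorem2p2:
  fixes x :: complex and \<delta> \<rho> k p a b :: real and n :: nat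
  assumes "x \<notin> scaled_neg_ints \<delta>"
    and "\<delta> > 0" and "\<rho> > 0" and "k > 0" and "p > 0" and "a > 0" and "b > 0"
    and "Re (x - complex_of_real (\<rho> * real n)) > 0"
  shows "ultra_Gamma \<delta> a \<rho> b x =
           complex_of_real (k / \<delta>) *
           ultra_Gamma k a (k * \<rho> / \<delta>) b (complex_of_real k * x / complex_of_real \<delta>)
         \<and> ultra_Gamma \<delta> a \<rho> b x =
           complex_of_real (k / \<delta>) * complex_of_real (a / p) powr (x / complex_of_real \<delta>) *
           ultra_Gamma k p (k * \<rho> / \<delta>) (b * (a / p) powr (\<rho> / \<delta>))
             (complex_of_real k * x / complex_of_real \<delta>)
         \<and> ultra_Gamma \<delta> a \<rho> b x =
           complex_of_real (a / p) powr (x / complex_of_real \<delta>) *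
           ultra_Gamma \<delta> p \<rho> (b * (a / p) powr (\<rho> / \<delta>)) x"
proof -
  \<comment> \<open>A single \<open>n\<close> suffices: subtracting the nonnegative
    \<open>\<rho> * real n\<close> can only lower the real part.\<close>
  have "0 < Re x - \<rho> * real n" "0 \<le> \<rho> * real n"
    using assms by auto
  then have x: "Re x > 0"
    by linarith
  \<comment> \<open>This scale solves \<open>a / c powr \<delta> = p\<close>, which trades the
    parameter \<open>a\<close> for \<open>p\<close>.\<close>
  define c where "c = (a / p) powr (1 / \<delta>)"
  have c: "c > 0" "a / c powr \<delta> = p" "c powr \<rho> = (a / p) powr (\<rho> / \<delta>)"
    using assms by (simp_all add: c_def powr_powr)
  have cx: "complex_of_real c powr x = complex_of_real (a / p) powr (x / complex_of_real \<delta>)"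
    using assms powr_of_real_powr[of "a / p" "1 / \<delta>" x] by (simp add: c_def)
  \<comment> \<open>The choice \<open>q = k / \<delta>\<close> turns the exponent
    \<open>\<delta>\<close> into \<open>k\<close>. The three relations are the cases of scale 1 with
    this \<open>q\<close>, scale \<open>c\<close> with this \<open>q\<close>, and scale
    \<open>c\<close> with \<open>q = 1\<close>.\<close>
  show ?thesis
    using ultra_Gamma_scaled_powr[of \<delta> a b x 1 "k / \<delta>" \<rho>]
          ultra_Gamma_scaled_powr[of \<delta> a b x c "k / \<delta>" \<rho>]
          ultra_Gamma_scaled_powr[of \<delta> a b x c 1 \<rho>] x c assms
    unfolding cx by simp
qed

end
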